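(* Let $\mu$ be Lebesgue measure on $[0,1]$, for $t\in[0,1]$ let $t^0=[0,t]$ and $t^1=[1-t,1]$, and let $\mathcal{I}_0=\{a^0 : 0\le a\le 1\}$. Define on $\mathcal{I}_0$ the operations $a^0\odot b^0=[\mu(a^0\cap b^1)]^0$ and $\neg a^0=[\mu([0,1]\setminus a^0)]^0$, and let $0=0^0=[0,0]$ and $1=1^0=[0,1]$. Then $(\mathcal{I}_0,\odot,\neg,1,0)$ is an MV-algebra (with $\odot$ as the monoid operation, $1=[0,1]$ as its identity element, and $0=[0,0]$ in the role of the last constant of the MV-algebra signature).
   Context: In $[\mu(X)]^0$ the real number $\mu(X)\in[0,1]$ plays the role of $t$, i.e. $[\mu(X)]^0=[0,\mu(X)]$. An MV-algebra is a structure $(A,+,\neg,e,u)$ such that $(A,+,e)$ is a commutative monoid with identity $e$, and for all $x,y\in A$: (i) $\neg(\neg x)=x$; (ii) $u+x=u$; (iii) $x+\neg e=\neg e$; (iv) $\neg(\neg x+y)+y=\neg(\neg y+x)+x$. *)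

theory Defs
  imports "HOL-Algebra.Group" "HOL-Analysis.Analysis"
begin

text \<open>Carrier-based MV-algebras. The membership assumptions for \<open>neg\<close> and \<open>u\<close> say that
  they are an operation and a constant of the carrier; closure of \<open>A\<close> under \<open>plus\<close> and
  \<open>e \<in> A\<close> are part of \<^const>\<open>comm_monoid\<close>.\<close>

locale mv_algebra =
  fixes A :: "'a set" and plus :: "'a \<Rightarrow> 'a \<Rightarrow> 'a" (infixl "\<boxplus>" 65)
    and neg :: "'a \<Rightarrow> 'a" and e :: 'a and u :: 'a
  assumes comm_monoid: "comm_monoid \<lparr>carrier = A, monoid.mult = (\<boxplus>), one = e\<rparr>"
    and neg_closed: "x \<in> A \<Longrightarrow> neg x \<in> A"
    and u_closed: "u \<in> A"
    and neg_neg: "x \<in> A \<Longrightarrow> neg (neg x) = x"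
    and u_absorb: "x \<in> A \<Longrightarrow> u \<boxplus> x = u"
    and neg_e_absorb: "x \<in> A \<Longrightarrow> x \<boxplus> neg e = neg e"
    and lukasiewicz: "x \<in> A \<Longrightarrow> y \<in> A \<Longrightarrow>
      neg (neg x \<boxplus> y) \<boxplus> y = neg (neg y \<boxplus> x) \<boxplus> x"

definition unit_measure :: "real set \<Rightarrow> real" where
  "unit_measure X = measure (lebesgue_on {0..1}) X"

definition seg0 :: "real \<Rightarrow> real set" where
  "seg0 t = {0..t}"

definition seg1 :: "real \<Rightarrow> real set" where
  "seg1 t = {1 - t..1}"

definition I0 :: "real set set" where
  "I0 = {seg0 a | a. 0 \<le> a \<and> a \<le> 1}"

text \<open>An element \<open>seg0 a\<close> of \<^const>\<open>I0\<close> determines \<open>a\<close>; this is what makes the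
  product, which refers to \<open>seg1 b\<close> for the second factor \<open>seg0 b\<close>, a function on sets.\<close>

definition param :: "real set \<Rightarrow> real" where
  "param X = (THE a. 0 \<le> a \<and> a \<le> 1 \<and> X = seg0 a)"

definition I0_times :: "real set \<Rightarrow> real set \<Rightarrow> real set" where
  "I0_times X Y = seg0 (unit_measure (X \<inter> seg1 (param Y)))"

definition I0_neg :: "real set \<Rightarrow> real set" where
  "I0_neg X = seg0 (unit_measure ({0..1} - X))"

lemma param_seg0:
  assumes "0 \<le> a" "a \<le> 1"
  shows "param (seg0 a) = a"
  unfolding param_def seg0_def using assms by (intro the_equality) auto

lemma I0_times_seg0:
  assumes "0 \<le> b" "b \<le> 1"
  shows "I0_times (seg0 a) (seg0 b) = seg0 (unit_measure (seg0 a \<inter> seg1 b))"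
  using assms by (simp add: I0_times_def param_seg0)

end

theory Submission imports Defs begin

text \<open>The map \<open>a \<mapsto> [0, a]\<close> is a bijection from the unit interval onto \<^const>\<open>I0\<close>, and it
  carries the product to the Lukasiewicz t-norm \<open>max 0 (a + b - 1)\<close> and the negation to
  \<open>1 - a\<close>. The axioms thereby become piecewise linear identities; both sides of the
  Lukasiewicz axiom equal \<open>min x y\<close>.\<close>

text \<open>Restricting to the measurable set \<open>{0..1}\<close> leaves the measure of its
  subsets unchanged, so interval lengths on the real line apply.\<close>

lemma unit_measure_eq_lebesgue:
  assumes "X \<subseteq> {0..1}"
  shows "unit_measure X = measure lebesgue X"
  unfolding unit_measure_def by (rule measure_restrict_space) (use assms in auto)

lemma I0_times_eq:
  assumes "0 \<le> a" "a \<le> 1" "0 \<le> b" "b \<le> 1"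
  shows "I0_times (seg0 a) (seg0 b) = seg0 (max 0 (a + b - 1))"
proof -
  have "seg0 a \<inter> seg1 b = {1 - b..a}"
    using assms by (auto simp: seg0_def seg1_def)
  \<comment> \<open>The truncation at 0 covers \<open>a + b < 1\<close>, where the interval is
    empty.\<close>
  moreover have "unit_measure {1 - b..a} = max 0 (a + b - 1)"
    using assms by (subst unit_measure_eq_lebesgue) (auto simp: max_def)
  ultimately show ?thesis
    using assms by (simp add: I0_times_seg0)
qed

lemma I0_neg_eq:
  assumes "0 \<le> a" "a \<le> 1"
  shows "I0_neg (seg0 a) = seg0 (1 - a)"
proof -
  have "{0..1} - seg0 a = {a<..1}"
    using assms by (auto simp: seg0_def)
  moreover have "unit_measure {a<..1} = 1 - a"
    using assms by (subst unit_measure_eq_lebesgue) auto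
  ultimately show ?thesis
    by (simp add: I0_neg_def)
qed

lemma seg0_in_I0: "0 \<le> a \<Longrightarrow> a \<le> 1 \<Longrightarrow> seg0 a \<in> I0"
  by (auto simp: I0_def)

lemma I0_cases:
  assumes "X \<in> I0"
  obtains a where "X = seg0 a" "0 \<le> a" "a \<le> 1"
  using assms by (auto simp: I0_def)

theorem theorem4: "mv_algebra I0 I0_times I0_neg (seg0 1) (seg0 0)"
proof (rule mv_algebra.intro)
  show "comm_monoid \<lparr>carrier = I0, monoid.mult = I0_times, one = seg0 1\<rparr>"
  proof (rule comm_monoidI, simp_all)
    fix X Y Z assume "X \<in> I0" "Y \<in> I0" "Z \<in> I0"
    \<comment> \<open>With parameters a, b, c, both sides are
      \<open>seg0 (max 0 (a + b + c - 2))\<close>; the inner truncation is harmless because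
      parameters are at most 1.\<close>
    then show "I0_times (I0_times X Y) Z = I0_times X (I0_times Y Z)"
      by (elim I0_cases) (auto simp: I0_times_eq max_def intro!: arg_cong[where f = seg0])
  qed (auto elim!: I0_cases simp: I0_times_eq seg0_in_I0 add.commute)
next
  fix X Y assume "X \<in> I0" "Y \<in> I0"
  then show "I0_times (I0_neg (I0_times (I0_neg X) Y)) Y
    = I0_times (I0_neg (I0_times (I0_neg Y) X)) X"
    by (elim I0_cases) (auto simp: I0_times_eq I0_neg_eq max_def)
qed (auto elim!: I0_cases simp: I0_times_eq I0_neg_eq seg0_in_I0)

end
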